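(* Let $A,B>0$, $k\in\mathbb R\setminus\{0\}$, and let $\chi_0\in\mathbb R\setminus\{0,k,-k\}$ be an exact real double branch point ($\Lambda'(\chi_0)=0$, $\Lambda''(\chi_0)\ne0$). The double-root plateau factors $\mathcal P_j^{(D)}=1-2h_j(\chi_0)$, $j=1,2$, satisfy $$\mathcal P_1^{(D)}=\frac{\chi_0-k}{\chi_0+k},\qquad \mathcal P_2^{(D)}=\frac{\chi_0+k}{\chi_0-k},$$ and hence $\mathcal P_1^{(D)}\mathcal P_2^{(D)}=1$. Neither factor equals $1$ or $-1$. Consequently $|\mathcal P_1^{(D)}|^2|\mathcal P_2^{(D)}|^2=1$, and precisely one of $|\mathcal P_1^{(D)}|,|\mathcal P_2^{(D)}|$ is larger than one while the other is smaller than one.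
   Context: $\Lambda(\chi)=\frac1\chi\big[2-k^2\big(\frac{A}{\chi+k}+\frac{B}{\chi-k}\big)\big]$ for $\chi\notin\{0,\pm k\}$; $h_1(\chi)=\frac{k}{k+\chi}$, $h_2(\chi)=\frac{k}{k-\chi}$. *)

theory Defs
  imports "HOL-Analysis.Analysis"
begin

text \<open>The formula is meant for \<open>x \<notin> {0, k, -k}\<close>; elsewhere the value is an artefact of division by zero.\<close>
definition Lambda :: "real \<Rightarrow> real \<Rightarrow> real \<Rightarrow> real \<Rightarrow> real" where
  "Lambda A B k x = (1 / x) * (2 - k\<^sup>2 * (A / (x + k) + B / (x - k)))"

definition h1 :: "real \<Rightarrow> real \<Rightarrow> real" where
  "h1 k x = k / (k + x)"

definition h2 :: "real \<Rightarrow> real \<Rightarrow> real" where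
  "h2 k x = k / (k - x)"

text \<open>\<open>Lambda A B k\<close> is smooth on the open set where \<open>x \<notin> {0, k, -k}\<close>, so there
  \<^const>\<open>deriv\<close> and its iterate are the actual first and second derivatives.\<close>
definition exact_double_branch_point :: "real \<Rightarrow> real \<Rightarrow> real \<Rightarrow> real \<Rightarrow> bool" where
  "exact_double_branch_point A B k x \<longleftrightarrow>
     x \<notin> {0, k, -k} \<and>
     deriv (Lambda A B k) x = 0 \<and>
     deriv (deriv (Lambda A B k)) x \<noteq> 0"

definition P1 :: "real \<Rightarrow> real \<Rightarrow> real" where
  "P1 k x = 1 - 2 * h1 k x"

definition P2 :: "real \<Rightarrow> real \<Rightarrow> real" where
  "P2 k x = 1 - 2 * h2 k x"

end

theory Submission
  imports Defs
begin

text \<open>Over a common denominator the two factors become Moebius quotients in \<open>x0\<close>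
  with numerator and denominator interchanged (\<open>P1_eq\<close>, \<open>P2_eq\<close>), so they
  are reciprocal. Either equals 1 only if \<open>k = 0\<close> and -1 only if \<open>x0 = 0\<close>.
  Being real, they thus have modulus different from 1, and \<open>abs_reciprocal_dichotomy\<close>
  places the moduli on opposite sides of 1.\<close>

lemma P1_eq:
  assumes "x + k \<noteq> 0"
  shows "P1 k x = (x - k) / (x + k)"
  using assms by (simp add: P1_def h1_def divide_simps add.commute)

lemma P2_eq:
  assumes "x - k \<noteq> 0"
  shows "P2 k x = (x + k) / (x - k)"
proof -
  \<comment> \<open>The sign flip turns the denominator \<open>k - x\<close> into the
    \<open>x - k\<close> of the assumption and the goal.\<close>
  have "h2 k x = - (k / (x - k))"
    by (simp add: h2_def minus_divide_right)
  then show ?thesis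
    using assms unfolding P2_def by (simp only:) (simp add: divide_simps)
qed

text \<open>Inversion \<open>t \<mapsto> 1 / t\<close> exchanges the intervals (0, 1) and (1,
  \<infinity>).\<close>

lemma abs_reciprocal_dichotomy:
  fixes p q :: real
  assumes "p * q = 1" and "\<bar>p\<bar> \<noteq> 1"
  shows "(\<bar>p\<bar> > 1 \<and> \<bar>q\<bar> < 1) \<or> (\<bar>p\<bar> < 1 \<and> \<bar>q\<bar> > 1)"
proof -
  have p: "\<bar>p\<bar> > 0"
    using assms(1) by auto
  then have q: "\<bar>q\<bar> = 1 / \<bar>p\<bar>"
    using assms(1) by (simp add: eq_divide_eq mult.commute flip: abs_mult)
  from assms(2) consider "\<bar>p\<bar> > 1" | "\<bar>p\<bar> < 1"
    by linarith
  then show ?thesis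
    unfolding q using p by cases simp_all
qed

theorem corollary41:
  fixes A B k x0 :: real
  assumes "A > 0" and "B > 0" and "k \<noteq> 0"
    and "x0 \<notin> {0, k, -k}"
    and "exact_double_branch_point A B k x0"
  shows "P1 k x0 = (x0 - k) / (x0 + k)
    \<and> P2 k x0 = (x0 + k) / (x0 - k)
    \<and> P1 k x0 * P2 k x0 = 1
    \<and> P1 k x0 \<notin> {1, -1}
    \<and> P2 k x0 \<notin> {1, -1}
    \<and> \<bar>P1 k x0\<bar>\<^sup>2 * \<bar>P2 k x0\<bar>\<^sup>2 = 1
    \<and> ((\<bar>P1 k x0\<bar> > 1 \<and> \<bar>P2 k x0\<bar> < 1) \<or> (\<bar>P1 k x0\<bar> < 1 \<and> \<bar>P2 k x0\<bar> > 1))"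
proof -
  have nz: "x0 + k \<noteq> 0" "x0 - k \<noteq> 0"
    using assms(4) by auto
  note eqs = P1_eq[OF nz(1)] P2_eq[OF nz(2)]
  have prod: "P1 k x0 * P2 k x0 = 1"
    using nz by (simp add: eqs)
  have P1: "P1 k x0 \<notin> {1, -1}" and P2: "P2 k x0 \<notin> {1, -1}"
    \<comment> \<open>With denominators cleared, the value 1 contradicts \<open>k \<noteq> 0\<close>
      and the value -1 contradicts \<open>x0 \<noteq> 0\<close>.\<close>
    using nz assms(3,4) by (auto simp: eqs divide_simps)
  have sq: "\<bar>P1 k x0\<bar>\<^sup>2 * \<bar>P2 k x0\<bar>\<^sup>2 = 1"
    using prod by (simp flip: power_mult_distrib)
  have "\<bar>P1 k x0\<bar> \<noteq> 1"
    using P1 by auto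
  from abs_reciprocal_dichotomy[OF prod this] show ?thesis
    using eqs prod P1 P2 sq by blast
qed

end
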